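(* In the graceful game, Bob has a winning strategy on every gear graph $G_n$, $n\geq 3$ (no matter who starts).
   Context: The gear graph $G_n$ ($n\geq 3$) is obtained from the wheel $W_n$ (a cycle $(v_0,\dots,v_{n-1})$ plus a central vertex $v_n$ adjacent to all $v_0,\dots,v_{n-1}$) by subdividing each edge $v_jv_{j+1}$ of the outer cycle exactly once, by a new vertex $w_j$ (indices mod $n$). It has $2n+1$ vertices and $3n$ edges. A graceful labeling of a graph $G$ with $m$ edges is an injective map $f\colon V(G)\to\{0,1,\dots,m\}$ such that the induced edge labels $|f(u)-f(v)|$, $uv\in E(G)$, are pairwise distinct. The graceful game on a simple graph $G$ with $m$ edges: two players, Alice and Bob, alternately choose a free (not yet labeled) vertex and assign to it a label from $\{0,1,\dots,m\}$ not yet used. An edge both of whose endpoints are labeled gets label $|f(u)-f(v)|$; a move is legal only if after it all edge labels are pairwise distinct. Alice wins if the whole graph ends up gracefully labeled; Bob wins if he can prevent this. Either player may be the first to move. *)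

theory Defs
  imports Main
begin

definition simple_graph :: "'v set \<Rightarrow> 'v set set \<Rightarrow> bool" where
  "simple_graph V E \<longleftrightarrow> finite V \<and> (\<forall>e\<in>E. e \<subseteq> V \<and> card e = 2)"

definition distinct_edge_labels :: "'v set set \<Rightarrow> ('v \<Rightarrow> nat) \<Rightarrow> bool" where
  "distinct_edge_labels E f \<longleftrightarrow>
     (\<forall>u v x y. {u, v} \<in> E \<longrightarrow> {x, y} \<in> E \<longrightarrow> {u, v} \<noteq> {x, y} \<longrightarrow>
        \<bar>int (f u) - int (f v)\<bar> \<noteq> \<bar>int (f x) - int (f y)\<bar>)"

definition graceful_labeling :: "'v set \<Rightarrow> 'v set set \<Rightarrow> ('v \<Rightarrow> nat) \<Rightarrow> bool" where
  "graceful_labeling V E f \<longleftrightarrow>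
     inj_on f V \<and> f ` V \<subseteq> {0..card E} \<and> distinct_edge_labels E f"


datatype player = Alice | Bob

fun opponent :: "player \<Rightarrow> player" where
  "opponent Alice = Bob"
| "opponent Bob = Alice"

text \<open>A move \<open>(v, a)\<close> assigns the label \<open>a\<close> to the vertex \<open>v\<close>. A play is the list of the moves
  made so far, in chronological order; since a legal play labels every vertex at most once,
  \<^const>\<open>map_of\<close> of it is the current partial labeling.\<close>

type_synonym 'v move = "'v \<times> nat"
type_synonym 'v play = "'v move list"

definition legal_move :: "'v set \<Rightarrow> 'v set set \<Rightarrow> 'v play \<Rightarrow> 'v move \<Rightarrow> bool" where
  "legal_move V E ms mv \<longleftrightarrow>
     (let p = map_of ms; v = fst mv; a = snd mv; p' = p(v \<mapsto> a) in
        v \<in> V \<and> v \<notin> dom p \<and> a \<in> {0..card E} \<and> a \<notin> ran p \<and>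
        distinct_edge_labels {e \<in> E. e \<subseteq> dom p'} (\<lambda>x. the (p' x)))"

inductive legal_play :: "'v set \<Rightarrow> 'v set set \<Rightarrow> 'v play \<Rightarrow> bool" for V E where
  start: "legal_play V E []"
| move: "legal_play V E ms \<Longrightarrow> legal_move V E ms mv \<Longrightarrow> legal_play V E (ms @ [mv])"

definition finished :: "'v set \<Rightarrow> 'v set set \<Rightarrow> 'v play \<Rightarrow> bool" where
  "finished V E ms \<longleftrightarrow> \<not> (\<exists>mv. legal_move V E ms mv)"

definition alice_wins :: "'v set \<Rightarrow> 'v set set \<Rightarrow> 'v play \<Rightarrow> bool" where
  "alice_wins V E ms \<longleftrightarrow>
     dom (map_of ms) = V \<and> graceful_labeling V E (\<lambda>x. the (map_of ms x))"

definition turn :: "player \<Rightarrow> 'v play \<Rightarrow> player" where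
  "turn first ms = (if even (length ms) then first else opponent first)"

definition follows :: "player \<Rightarrow> player \<Rightarrow> ('v play \<Rightarrow> 'v move) \<Rightarrow> 'v play \<Rightarrow> bool" where
  "follows first q \<sigma> ms \<longleftrightarrow>
     (\<forall>k < length ms. turn first (take k ms) = q \<longrightarrow> ms ! k = \<sigma> (take k ms))"

text \<open>The first conjunct makes Bob's strategy prescribe a legal move whenever he has one, so that he
  cannot win by refusing to move. Whether a move is legal does not depend on who makes it, so a
  play gets stuck for both players at once, and Bob wins if it does so before all vertices
  are labeled. Plays are finite when \<open>V\<close> is.\<close>

definition bob_winning_strategy ::
  "'v set \<Rightarrow> 'v set set \<Rightarrow> player \<Rightarrow> ('v play \<Rightarrow> 'v move) \<Rightarrow> bool" where
  "bob_winning_strategy V E first \<sigma> \<longleftrightarrow>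
     (\<forall>ms. legal_play V E ms \<and> follows first Bob \<sigma> ms \<longrightarrow>
        (turn first ms = Bob \<and> \<not> finished V E ms \<longrightarrow> legal_move V E ms (\<sigma> ms)) \<and>
        (finished V E ms \<longrightarrow> \<not> alice_wins V E ms))"


text \<open>\<open>Rim j\<close> is the outer wheel vertex \<open>v\<^sub>j\<close>, \<open>Hub\<close> the centre \<open>v\<^sub>n\<close>, and \<open>Mid j\<close> the
  vertex \<open>w\<^sub>j\<close> subdividing the outer edge from \<open>v\<^sub>j\<close> to its successor.\<close>

datatype gear_vertex = Hub | Rim nat | Mid nat

definition gear_verts :: "nat \<Rightarrow> gear_vertex set" where
  "gear_verts n = {Hub} \<union> Rim ` {..<n} \<union> Mid ` {..<n}"

definition gear_edges :: "nat \<Rightarrow> gear_vertex set set" where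
  "gear_edges n =
     (\<Union>j<n. {{Hub, Rim j}, {Rim j, Mid j}, {Mid j, Rim ((j + 1) mod n)}})"

lemma simple_graph_gear: "simple_graph (gear_verts n) (gear_edges n)"
  by (auto simp: simple_graph_def gear_verts_def gear_edges_def card_insert_if)

lemma card_gear_verts: "card (gear_verts n) = 2 * n + 1"
proof -
  have "card (Rim ` {..<n} \<union> Mid ` {..<n}) = 2 * n"
    by (subst card_Un_disjoint) (auto simp: card_image inj_on_def)
  moreover have "gear_verts n = insert Hub (Rim ` {..<n} \<union> Mid ` {..<n})"
    by (auto simp: gear_verts_def)
  moreover have "Hub \<notin> Rim ` {..<n} \<union> Mid ` {..<n}" by auto
  ultimately show ?thesis by simp
qed

lemma card_gear_edges:
  assumes "n \<ge> 3"
  shows "card (gear_edges n) = 3 * n"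
proof -
  let ?A = "(\<lambda>j. {Hub, Rim j}) ` {..<n}"
  let ?B = "(\<lambda>j. {Rim j, Mid j}) ` {..<n}"
  let ?C = "(\<lambda>j. {Mid j, Rim ((j + 1) mod n)}) ` {..<n}"
  have eq: "gear_edges n = ?A \<union> (?B \<union> ?C)" by (auto simp: gear_edges_def)
  have cards: "card ?A = n" "card ?B = n" "card ?C = n"
    by (auto simp: card_image inj_on_def doubleton_eq_iff)
  have ne: "(j + 1) mod n \<noteq> j" if "j < n" for j
    using that assms by (cases "j + 1 = n") auto
  have BC: "?B \<inter> ?C = {}" using ne by (auto simp: doubleton_eq_iff)
  have ABC: "?A \<inter> (?B \<union> ?C) = {}" by (auto simp: doubleton_eq_iff)
  have "card (?B \<union> ?C) = 2 * n" using cards BC by (subst card_Un_disjoint) auto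
  then show ?thesis unfolding eq using cards ABC by (subst card_Un_disjoint) auto
qed

end

theory Submission
  imports Defs
begin

text \<open>With \<open>m\<close> edges, a graceful labeling attains every edge label \<open>1, \<dots>, m\<close>. So \<open>0\<close> and \<open>m\<close>
  must be adjacent, and edge label \<open>m - 1\<close> needs an edge labeled \<open>{0, m - 1}\<close> or \<open>{1, m}\<close>.
  Bob puts \<open>0\<close> on a vertex \<open>w\<close> with exactly two free neighbours. If Alice answers on the side of
  \<open>w\<close> in the bipartition, Bob separates \<open>m\<close> from \<open>0\<close> by playing it on that side as well.
  Otherwise the labeled edges form a star at \<open>w\<close>, and Bob plays the least unused label
  on a free neighbour of \<open>w\<close>. Then at most one neighbour of \<open>w\<close> can get a label in
  \<open>{m - 1, m}\<close>, and \<open>1\<close> is on the side opposite to \<open>w\<close>, where \<open>m\<close> has to go, so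
  edge label \<open>m - 1\<close> is lost. Replacing each label \<open>a\<close> by \<open>m - a\<close> allows us to assume that
  Alice's first label is at most \<open>m / 2\<close>, which keeps Bob's moves legal. If it is \<open>0\<close>, Bob
  separates \<open>m\<close> from it at once. If it is \<open>m / 2\<close> on the hub, Bob chooses \<open>w\<close> on the side of
  the hub, and separates \<open>m\<close> from \<open>0\<close> unless Alice puts \<open>m\<close> next to \<open>w\<close>, when he plays \<open>1\<close> on
  the other neighbour of \<open>w\<close>.\<close>

subsection \<open>Positions\<close>

lemma ex_less_notin_if_card_less:
  fixes A :: "nat set"
  assumes "finite A" "card A < k"
  shows "\<exists>i<k. i \<notin> A"
proof -
  have "\<not> {..<k} \<subseteq> A" using assms card_mono[of A "{..<k}"] by auto
  then show ?thesis by auto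
qed

lemma least_unused_label:
  fixes p :: "'v \<rightharpoonup> nat"
  assumes "finite (dom p)"
  obtains l where "l \<notin> ran p" "l \<le> card (dom p)" "\<And>k. k < l \<Longrightarrow> k \<in> ran p"
proof
  define l where "l = (LEAST l. l \<notin> ran p)"
  have ran: "ran p = (the \<circ> p) ` dom p" by (force simp: ran_def image_iff)
  then have "card (ran p) \<le> card (dom p)" using card_image_le[OF assms] by simp
  then obtain i where i: "i \<le> card (dom p)" "i \<notin> ran p"
    using ex_less_notin_if_card_less[of "ran p" "Suc (card (dom p))"] assms
    by (auto simp: ran less_Suc_eq_le)
  show "l \<notin> ran p" unfolding l_def using i(2) by (rule LeastI)
  show "l \<le> card (dom p)" unfolding l_def using i Least_le by (metis le_trans)
  show "k \<in> ran p" if "k < l" for k using that not_less_Least unfolding l_def by blast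
qed

lemma follows_snoc:
  "follows first q \<sigma> (ms @ [mv]) \<longleftrightarrow>
    follows first q \<sigma> ms \<and> (turn first ms = q \<longrightarrow> mv = \<sigma> ms)"
  by (auto simp: follows_def less_Suc_eq nth_append)

lemma turn_snoc: "turn first (ms @ [mv]) = opponent (turn first ms)"
  by (cases first) (auto simp: turn_def)

lemma map_of_snoc:
  "map_of ms v = None \<Longrightarrow> map_of (ms @ [(v, a)]) = (map_of ms)(v \<mapsto> a)"
  by (simp add: map_add_upd_left domIff)

lemma distinct_edge_labels_complement:
  assumes "distinct_edge_labels E f" "\<And>e v. e \<in> E \<Longrightarrow> v \<in> e \<Longrightarrow> f v \<le> k \<and> g v = k - f v"
  shows "distinct_edge_labels E g"
proof -
  have "\<bar>int (g u) - int (g v)\<bar> = \<bar>int (f u) - int (f v)\<bar>" if "{u, v} \<in> E" for u v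
    using assms(2)[OF that, of u] assms(2)[OF that, of v] by auto
  with assms(1) show ?thesis unfolding distinct_edge_labels_def by simp
qed

locale labeling_game =
  fixes V :: "'v set" and E :: "'v set set"
  assumes simple_graph: "simple_graph V E"
begin

abbreviation m :: nat where
  "m \<equiv> card E"

definition neighbours :: "'v \<Rightarrow> 'v set" where
  "neighbours v = {t. {v, t} \<in> E}"

lemma finite_verts: "finite V"
  using simple_graph by (simp add: simple_graph_def)

lemma edge_subset_verts: "e \<in> E \<Longrightarrow> e \<subseteq> V"
  using simple_graph by (simp add: simple_graph_def)

lemma edge_in_verts:
  assumes "{u, v} \<in> E"
  shows "u \<in> V" "v \<in> V"
  using edge_subset_verts[OF assms] by auto

lemma no_loop: "{v} \<notin> E"
  using simple_graph by (auto simp: simple_graph_def)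

lemma edge_irrefl: "{u, v} \<in> E \<Longrightarrow> u \<noteq> v"
  using no_loop[of v] by auto

lemma graceful_labeling_le: "graceful_labeling V E f \<Longrightarrow> v \<in> V \<Longrightarrow> f v \<le> m"
  by (auto simp: graceful_labeling_def)

lemma graceful_labeling_inj:
  "graceful_labeling V E f \<Longrightarrow> f u = f v \<Longrightarrow> u \<in> V \<Longrightarrow> v \<in> V \<Longrightarrow> u = v"
  by (auto simp: graceful_labeling_def dest: inj_onD)

definition partial_graceful :: "('v \<rightharpoonup> nat) \<Rightarrow> bool" where
  "partial_graceful p \<longleftrightarrow> dom p \<subseteq> V \<and> ran p \<subseteq> {..m} \<and> inj_on p (dom p) \<and>
     distinct_edge_labels {e \<in> E. e \<subseteq> dom p} (\<lambda>v. the (p v))"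

definition edge_labels :: "('v \<rightharpoonup> nat) \<Rightarrow> int set" where
  "edge_labels p = {\<bar>int a - int b\<bar> | u v a b. {u, v} \<in> E \<and> p u = Some a \<and> p v = Some b}"

definition legal :: "('v \<rightharpoonup> nat) \<Rightarrow> 'v \<Rightarrow> nat \<Rightarrow> bool" where
  "legal p v a \<longleftrightarrow> v \<in> V \<and> p v = None \<and> partial_graceful (p(v \<mapsto> a))"

lemma partial_graceful_dom: "partial_graceful p \<Longrightarrow> dom p \<subseteq> V"
  by (simp add: partial_graceful_def)

lemma partial_graceful_le: "partial_graceful p \<Longrightarrow> p v = Some a \<Longrightarrow> a \<le> m"
  by (auto simp: partial_graceful_def ran_def)

lemma partial_graceful_inj:
  "partial_graceful p \<Longrightarrow> p u = Some a \<Longrightarrow> p v = Some a \<Longrightarrow> u = v"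
  unfolding partial_graceful_def inj_on_def by (metis domI)

lemma partial_graceful_empty: "partial_graceful Map.empty"
  using edge_irrefl by (auto simp: partial_graceful_def distinct_edge_labels_def)

lemma partial_graceful_upd_iff:
  assumes "p v = None"
  shows "partial_graceful (p(v \<mapsto> a)) \<longleftrightarrow>
    v \<in> V \<and> dom p \<subseteq> V \<and> a \<le> m \<and> ran p \<subseteq> {..m} \<and> inj_on p (dom p) \<and> a \<notin> ran p \<and>
    distinct_edge_labels {e \<in> E. e \<subseteq> insert v (dom p)} (\<lambda>x. the ((p(v \<mapsto> a)) x))"
proof -
  have "inj_on (p(v \<mapsto> a)) (insert v (dom p)) \<longleftrightarrow> inj_on p (dom p) \<and> a \<notin> ran p"
    using assms by (force simp: inj_on_def ran_def dom_def)
  then show ?thesis using assms by (auto simp: partial_graceful_def simp del: inj_on_insert)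
qed

lemma legal_le: "legal p v a \<Longrightarrow> a \<le> m"
  by (auto simp: legal_def partial_graceful_upd_iff)

lemma edge_label_upd_cases:
  assumes "{s, t} \<in> E" "{s, t} \<subseteq> dom (p(v \<mapsto> a))"
  defines "l \<equiv> \<lambda>q. \<bar>int (the (q s)) - int (the (q t))\<bar>"
  obtains (new) u b where "{s, t} = {v, u}" "{v, u} \<in> E" "p u = Some b"
      "l (p(v \<mapsto> a)) = \<bar>int a - int b\<bar>"
    | (old) "{s, t} \<subseteq> dom p" "l (p(v \<mapsto> a)) = l p" "l p \<in> edge_labels p"
proof -
  have "s \<noteq> t" using assms(1) by (rule edge_irrefl)
  consider "s = v" | "t = v" | "s \<noteq> v" "t \<noteq> v" by blast
  then show thesis
  proof cases
    case 1
    then show thesis using assms \<open>s \<noteq> t\<close> by (auto intro: new)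
  next
    case 2
    then show thesis
      using assms \<open>s \<noteq> t\<close> new[of s] by (auto simp: insert_commute abs_minus_commute)
  next
    case 3
    then show thesis using assms old by (force simp: edge_labels_def)
  qed
qed

lemma legalI:
  assumes p: "partial_graceful p" and v: "v \<in> V" "p v = None" and a: "a \<le> m" "a \<notin> ran p"
    and fresh: "\<And>t b. {v, t} \<in> E \<Longrightarrow> p t = Some b \<Longrightarrow> \<bar>int a - int b\<bar> \<notin> edge_labels p"
    and distinct: "\<And>s t b c. {v, s} \<in> E \<Longrightarrow> {v, t} \<in> E \<Longrightarrow> p s = Some b \<Longrightarrow> p t = Some c \<Longrightarrow>
      \<bar>int a - int b\<bar> = \<bar>int a - int c\<bar> \<Longrightarrow> s = t"
  shows "legal p v a"
proof -
  let ?q = "p(v \<mapsto> a)"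
  let ?l = "\<lambda>q s t. \<bar>int (the (q s)) - int (the (q t))\<bar>"
  have "?l ?q s t \<noteq> ?l ?q x y"
    if st: "{s, t} \<in> E" "{s, t} \<subseteq> dom ?q" and xy: "{x, y} \<in> E" "{x, y} \<subseteq> dom ?q"
      and ne: "{s, t} \<noteq> {x, y}" for s t x y
    using st
  proof (cases rule: edge_label_upd_cases)
    case st_new: (new u b)
    from xy show ?thesis
    proof (cases rule: edge_label_upd_cases)
      case (new u' b')
      with st_new ne distinct[of u u' b b'] show ?thesis by auto
    next
      case old
      with st_new fresh[of u b] show ?thesis by metis
    qed
  next
    case st_old: old
    from xy show ?thesis
    proof (cases rule: edge_label_upd_cases)
      case (new u b)
      with st_old fresh[of u b] show ?thesis by metis
    next
      case old
      with p st xy ne st_old show ?thesis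
        unfolding partial_graceful_def distinct_edge_labels_def by simp
    qed
  qed
  then have "distinct_edge_labels {e \<in> E. e \<subseteq> dom ?q} (\<lambda>x. the (?q x))"
    by (simp add: distinct_edge_labels_def del: fun_upd_apply dom_fun_upd)
  with p v a show ?thesis
    by (simp add: legal_def partial_graceful_upd_iff) (simp add: partial_graceful_def)
qed

lemma legal_if_no_labeled_neighbour:
  assumes "partial_graceful p" "v \<in> V" "p v = None" "a \<le> m" "a \<notin> ran p"
    and "neighbours v \<inter> dom p = {}"
  shows "legal p v a"
  using assms by (intro legalI) (auto simp: neighbours_def disjoint_iff)

lemma legal_empty: "v \<in> V \<Longrightarrow> a \<le> m \<Longrightarrow> legal Map.empty v a"
  by (rule legal_if_no_labeled_neighbour) (simp_all add: partial_graceful_empty)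

lemma legal_singleton:
  assumes "u \<in> V" "v \<in> V" "u \<noteq> v" "a \<le> m" "b \<le> m" "a \<noteq> b"
  shows "legal [u \<mapsto> a] v b"
proof -
  have "partial_graceful [u \<mapsto> a]" using legal_empty assms(1,4) by (simp add: legal_def)
  moreover have "edge_labels [u \<mapsto> a] = {}"
    using no_loop by (auto simp: edge_labels_def split: if_splits)
  ultimately show ?thesis using assms by (intro legalI) (auto split: if_splits)
qed

lemma legal_move_iff_legal:
  assumes "partial_graceful (map_of ms)"
  shows "legal_move V E ms (v, a) \<longleftrightarrow> legal (map_of ms) v a"
proof (cases "map_of ms v")
  case None
  then show ?thesis
    using assms unfolding legal_def partial_graceful_upd_iff[where p = "map_of ms", OF None]
    by (auto simp: legal_move_def partial_graceful_def Let_def)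
qed (auto simp: legal_move_def legal_def Let_def)

lemma partial_graceful_map_of_legal_play: "legal_play V E ms \<Longrightarrow> partial_graceful (map_of ms)"
proof (induction rule: legal_play.induct)
  case start
  show ?case by (simp add: partial_graceful_empty)
next
  case (move ms mv)
  obtain v a where mv: "mv = (v, a)" by (cases mv)
  then have "legal (map_of ms) v a" using move.hyps(2) move.IH by (simp add: legal_move_iff_legal)
  then show ?case by (simp add: legal_def mv map_of_snoc del: map_of_append fun_upd_apply)
qed


subsection \<open>Winning positions\<close>

definition doomed :: "('v \<rightharpoonup> nat) \<Rightarrow> bool" where
  "doomed p \<longleftrightarrow> \<not> (\<exists>f. graceful_labeling V E f \<and> p \<subseteq>\<^sub>m Some \<circ> f)"

text \<open>With \<open>dom p \<noteq> V\<close>, a position in which Alice is stuck counts as a win for Bob only if some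
  vertex is still unlabeled.\<close>

inductive bob_wins :: "player \<Rightarrow> ('v \<rightharpoonup> nat) \<Rightarrow> bool" where
  doomed: "doomed p \<Longrightarrow> bob_wins q p"
| bob_move: "legal p v a \<Longrightarrow> bob_wins Alice (p(v \<mapsto> a)) \<Longrightarrow> bob_wins Bob p"
| alice_move: "dom p \<noteq> V \<Longrightarrow> (\<And>v a. legal p v a \<Longrightarrow> bob_wins Bob (p(v \<mapsto> a))) \<Longrightarrow>
    bob_wins Alice p"

lemma doomed_upd: "doomed p \<Longrightarrow> p v = None \<Longrightarrow> doomed (p(v \<mapsto> a))"
  unfolding doomed_def map_le_def by (metis domIff fun_upd_apply)

lemma bob_wins_if_doomed_upd: "legal p v a \<Longrightarrow> doomed (p(v \<mapsto> a)) \<Longrightarrow> bob_wins Bob p"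
  by (rule bob_wins.bob_move[OF _ bob_wins.doomed])

lemma ex_bob_move_if_bob_wins:
  assumes ms: "legal_play V E ms" "bob_wins Bob (map_of ms)" "\<not> finished V E ms"
  shows "\<exists>mv. legal_move V E ms mv \<and> bob_wins Alice (map_of (ms @ [mv]))"
proof -
  note legal_iff = legal_move_iff_legal[OF partial_graceful_map_of_legal_play[OF ms(1)]]
  obtain u b where ub: "legal (map_of ms) u b" using ms(3) legal_iff by (auto simp: finished_def)
  from ms(2) obtain v a where "legal (map_of ms) v a" "bob_wins Alice ((map_of ms)(v \<mapsto> a))"
  proof cases
    case doomed
    with ub that show ?thesis by (simp add: legal_def doomed_upd bob_wins.doomed)
  qed blast
  then have "legal_move V E ms (v, a)" "bob_wins Alice (map_of (ms @ [(v, a)]))"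
    using legal_iff by (simp_all add: legal_def map_of_snoc del: map_of_append)
  then show ?thesis by blast
qed

lemma bob_wins_alice_move:
  assumes ms: "legal_play V E ms" "bob_wins Alice (map_of ms)" "legal_move V E ms mv"
  shows "bob_wins Bob (map_of (ms @ [mv]))"
proof -
  obtain v a where mv: "mv = (v, a)" by (cases mv)
  then have legal: "legal (map_of ms) v a"
    using ms legal_move_iff_legal partial_graceful_map_of_legal_play by blast
  from ms(2) have "bob_wins Bob ((map_of ms)(v \<mapsto> a))"
  proof cases
    case doomed
    with legal show ?thesis by (simp add: legal_def doomed_upd bob_wins.doomed)
  qed (use legal in blast)
  then show ?thesis using legal by (simp add: mv legal_def map_of_snoc del: map_of_append)
qed

lemma not_alice_wins_if_bob_wins:
  assumes "bob_wins q (map_of ms)" "partial_graceful (map_of ms)" "finished V E ms"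
  shows "\<not> alice_wins V E ms"
  using assms(1)
proof cases
  case doomed
  then show ?thesis
    by (auto simp: doomed_def alice_wins_def map_le_def)
next
  case (bob_move v a)
  then show ?thesis using assms(2,3) legal_move_iff_legal unfolding finished_def by blast
next
  case alice_move
  then show ?thesis by (simp add: alice_wins_def)
qed

lemma ex_bob_winning_strategy:
  assumes "bob_wins first Map.empty"
  shows "\<exists>\<sigma>. bob_winning_strategy V E first \<sigma>"
proof -
  let ?good = "\<lambda>ms mv. legal_move V E ms mv \<and> bob_wins Alice (map_of (ms @ [mv]))"
  define \<sigma> where "\<sigma> ms = (SOME mv. ?good ms mv)" for ms
  have \<sigma>: "?good ms (\<sigma> ms)"
    if "legal_play V E ms" "bob_wins Bob (map_of ms)" "\<not> finished V E ms" for ms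
    unfolding \<sigma>_def using ex_bob_move_if_bob_wins[OF that] by (rule someI_ex)
  have wins: "bob_wins (turn first ms) (map_of ms)"
    if "legal_play V E ms" "follows first Bob \<sigma> ms" for ms
    using that
  proof (induction rule: legal_play.induct)
    case start
    then show ?case using assms by (simp add: turn_def)
  next
    case (move ms mv)
    have IH: "bob_wins (turn first ms) (map_of ms)" using move by (simp add: follows_snoc)
    show ?case
    proof (cases "turn first ms")
      case Alice
      then show ?thesis
        using bob_wins_alice_move move.hyps IH by (simp add: turn_snoc del: map_of_append)
    next
      case Bob
      then have "mv = \<sigma> ms" using move.prems by (simp add: follows_snoc)
      moreover have "\<not> finished V E ms" using move.hyps(2) unfolding finished_def by blast
      ultimately show ?thesis
        using \<sigma>[of ms] move.hyps IH Bob by (simp add: turn_snoc del: map_of_append)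
    qed
  qed
  have "(turn first ms = Bob \<and> \<not> finished V E ms \<longrightarrow> legal_move V E ms (\<sigma> ms)) \<and>
      (finished V E ms \<longrightarrow> \<not> alice_wins V E ms)"
    if ms: "legal_play V E ms" "follows first Bob \<sigma> ms" for ms
    using wins[OF ms] \<sigma>[OF ms(1)] partial_graceful_map_of_legal_play[OF ms(1)]
      not_alice_wins_if_bob_wins by auto
  then show ?thesis unfolding bob_winning_strategy_def by blast
qed


subsection \<open>Complementary labels\<close>

definition complement :: "('v \<rightharpoonup> nat) \<Rightarrow> 'v \<rightharpoonup> nat" where
  "complement p = map_option (\<lambda>a. m - a) \<circ> p"

lemma complement_upd: "complement (p(v \<mapsto> a)) = (complement p)(v \<mapsto> m - a)"
  by (simp add: complement_def fun_eq_iff)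

lemma complement_complement:
  assumes "partial_graceful p"
  shows "complement (complement p) = p"
proof
  fix v show "complement (complement p) v = p v"
    using partial_graceful_le[OF assms, of v] by (cases "p v") (simp_all add: complement_def)
qed

lemma dom_complement: "dom (complement p) = dom p"
  by (auto simp: complement_def)

lemma partial_graceful_complement:
  assumes p: "partial_graceful p"
  shows "partial_graceful (complement p)"
proof -
  have "distinct_edge_labels {e \<in> E. e \<subseteq> dom p} (\<lambda>v. the (complement p v))"
  proof (rule distinct_edge_labels_complement)
    show "distinct_edge_labels {e \<in> E. e \<subseteq> dom p} (\<lambda>v. the (p v))"
      using p by (simp add: partial_graceful_def)
    show "the (p v) \<le> m \<and> the (complement p v) = m - the (p v)"
      if "e \<in> {e \<in> E. e \<subseteq> dom p}" "v \<in> e" for e v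
    proof -
      have "v \<in> dom p" using that by auto
      then obtain a where "p v = Some a" by auto
      then show ?thesis using partial_graceful_le[OF p] by (simp add: complement_def)
    qed
  qed
  moreover have "inj_on (complement p) (dom p)"
  proof (rule inj_onI)
    fix u v assume "u \<in> dom p" "v \<in> dom p" "complement p u = complement p v"
    then obtain a b where ab: "p u = Some a" "p v = Some b" "m - a = m - b"
      by (auto simp: complement_def)
    then have "a = b" using partial_graceful_le[OF p] by (metis diff_diff_cancel)
    with ab partial_graceful_inj[OF p] show "u = v" by blast
  qed
  moreover have "ran (complement p) \<subseteq> {..m}" by (auto simp: complement_def ran_def)
  ultimately show ?thesis using p by (simp add: partial_graceful_def dom_complement)
qed

lemma legal_complement: "legal p v a \<Longrightarrow> legal (complement p) v (m - a)"
  using partial_graceful_complement[of "p(v \<mapsto> a)"] unfolding legal_def complement_upd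
  by (simp add: complement_def)

lemma graceful_labeling_complement:
  assumes f: "graceful_labeling V E f"
  shows "graceful_labeling V E (\<lambda>v. m - f v)"
proof -
  note le = graceful_labeling_le[OF f]
  have "inj_on (\<lambda>v. m - f v) V"
    using f le unfolding graceful_labeling_def inj_on_def by (metis diff_diff_cancel)
  moreover have "distinct_edge_labels E (\<lambda>v. m - f v)"
  proof (rule distinct_edge_labels_complement)
    show "distinct_edge_labels E f" using f by (simp add: graceful_labeling_def)
  qed (use le edge_subset_verts in blast)
  ultimately show ?thesis by (auto simp: graceful_labeling_def)
qed

lemma doomed_complement:
  assumes "doomed p" "partial_graceful p"
  shows "doomed (complement p)"
  unfolding doomed_def
proof
  assume "\<exists>f. graceful_labeling V E f \<and> complement p \<subseteq>\<^sub>m Some \<circ> f"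
  then obtain f where f: "graceful_labeling V E f" "complement p \<subseteq>\<^sub>m Some \<circ> f" by blast
  have "m - f v = a" if "p v = Some a" for v a
  proof -
    have "f v = m - a" using f(2) that by (force simp: map_le_def complement_def dom_def)
    then show ?thesis using partial_graceful_le[OF assms(2) that] by simp
  qed
  then have "p \<subseteq>\<^sub>m Some \<circ> (\<lambda>v. m - f v)" by (auto simp: map_le_def)
  with graceful_labeling_complement[OF f(1)] assms(1) show False by (auto simp: doomed_def)
qed

lemma bob_wins_complement:
  "bob_wins q p \<Longrightarrow> partial_graceful p \<Longrightarrow> bob_wins q (complement p)"
proof (induction rule: bob_wins.induct)
  case (doomed p q)
  then show ?case by (simp add: bob_wins.doomed doomed_complement)
next
  case (bob_move p v a)
  then have "bob_wins Alice ((complement p)(v \<mapsto> m - a))"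
    by (simp add: legal_def complement_upd del: fun_upd_apply)
  with legal_complement[OF bob_move.hyps(1)] show ?case by (rule bob_wins.bob_move)
next
  case (alice_move p)
  show ?case
  proof (rule bob_wins.alice_move)
    show "dom (complement p) \<noteq> V" using alice_move.hyps by (simp add: dom_complement)
    fix v a assume legal: "legal (complement p) v a"
    then have "legal p v (m - a)"
      using legal_complement[OF legal] complement_complement[OF alice_move.prems] by simp
    from alice_move.IH[OF this] this legal_le[OF legal]
    show "bob_wins Bob ((complement p)(v \<mapsto> a))"
      by (simp add: legal_def complement_upd del: fun_upd_apply)
  qed
qed

lemma bob_wins_if_wins_against_small_openings:
  assumes "V \<noteq> {}" and small: "\<And>v a. v \<in> V \<Longrightarrow> 2 * a \<le> m \<Longrightarrow> bob_wins Bob [v \<mapsto> a]"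
  shows "bob_wins Alice Map.empty"
proof (rule bob_wins.alice_move)
  show "dom Map.empty \<noteq> V" using assms(1) by simp
  fix v a assume legal: "legal Map.empty v a"
  show "bob_wins Bob [v \<mapsto> a]"
  proof (cases "2 * a \<le> m")
    case True
    with legal small show ?thesis by (simp add: legal_def)
  next
    case False
    have "partial_graceful [v \<mapsto> m - a]"
      using legal legal_empty[of v "m - a"] by (simp add: legal_def)
    moreover have "bob_wins Bob [v \<mapsto> m - a]" using False legal small by (simp add: legal_def)
    ultimately have "bob_wins Bob (complement [v \<mapsto> m - a])" by (intro bob_wins_complement)
    then show ?thesis using legal_le[OF legal] by (simp add: complement_def)
  qed
qed


subsection \<open>Lost edge labels\<close>

definition edge_label :: "('v \<Rightarrow> nat) \<Rightarrow> 'v set \<Rightarrow> nat" where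
  "edge_label f e = Max (f ` e) - Min (f ` e)"

lemma edge_label_doubleton: "edge_label f {u, v} = nat \<bar>int (f u) - int (f v)\<bar>"
  by (auto simp: edge_label_def max_def min_def)

lemma edge_doubletonE:
  assumes "e \<in> E"
  obtains u v where "e = {u, v}"
  using assms simple_graph by (auto simp: simple_graph_def card_2_iff)

lemma graceful_edge_label_image:
  assumes f: "graceful_labeling V E f"
  shows "edge_label f ` E = {1..m}"
proof (rule card_subset_eq)
  show "edge_label f ` E \<subseteq> {1..m}"
  proof
    fix l assume "l \<in> edge_label f ` E"
    then obtain u v where uv: "{u, v} \<in> E" "l = edge_label f {u, v}"
      by (metis edge_doubletonE imageE)
    then have "f u \<noteq> f v" using graceful_labeling_inj[OF f] edge_in_verts edge_irrefl by metis
    then show "l \<in> {1..m}"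
      using uv edge_in_verts[OF uv(1)]
        graceful_labeling_le[OF f, of u] graceful_labeling_le[OF f, of v]
      by (auto simp: edge_label_doubleton)
  qed
  have "inj_on (edge_label f) E"
  proof (rule inj_onI)
    fix e e' assume e: "e \<in> E" "e' \<in> E" "edge_label f e = edge_label f e'"
    obtain u v x y where "e = {u, v}" "e' = {x, y}" using edge_doubletonE e by metis
    moreover from this e(3) have "\<bar>int (f u) - int (f v)\<bar> = \<bar>int (f x) - int (f y)\<bar>"
      by (simp add: edge_label_doubleton eq_nat_nat_iff)
    ultimately show "e = e'"
      using f e(1,2) unfolding graceful_labeling_def distinct_edge_labels_def by blast
  qed
  then show "card (edge_label f ` E) = card {1..m}" by (simp add: card_image)
qed simp

lemma graceful_edge_label_attained:
  assumes "graceful_labeling V E f" "1 \<le> k" "k \<le> m"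
  obtains u v where "{u, v} \<in> E" "f v = f u + k"
proof -
  have "k \<in> edge_label f ` E" using assms by (simp add: graceful_edge_label_image)
  then obtain u v where uv: "{u, v} \<in> E" "k = nat \<bar>int (f u) - int (f v)\<bar>"
    by (metis edge_doubletonE edge_label_doubleton imageE)
  show ?thesis
  proof (cases "f u \<le> f v")
    case True
    then show ?thesis using that[of u v] uv by auto
  next
    case False
    then show ?thesis using that[of v u] uv by (auto simp: insert_commute)
  qed
qed

lemma graceful_zero_has_maximal_neighbour:
  assumes f: "graceful_labeling V E f" and w: "w \<in> V" "f w = 0" and m: "0 < m"
  obtains t where "{w, t} \<in> E" "f t = m"
proof -
  obtain s t where st: "{s, t} \<in> E" "f t = f s + m"
    using graceful_edge_label_attained[OF f, of m] m by auto
  have "f s = 0" "f t = m"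
    using st graceful_labeling_le[OF f edge_in_verts(2)[OF st(1)]] by auto
  moreover from this have "s = w"
    using graceful_labeling_inj[OF f] w edge_in_verts(1)[OF st(1)] by simp
  ultimately show ?thesis using that st(1) by simp
qed

lemma doomed_if_extreme_labels_apart:
  assumes "0 < m" "dom p \<subseteq> V" and u: "p u = Some 0" and v: "p v = Some m" and "{u, v} \<notin> E"
  shows "doomed p"
  unfolding doomed_def
proof
  assume "\<exists>f. graceful_labeling V E f \<and> p \<subseteq>\<^sub>m Some \<circ> f"
  then obtain f where f: "graceful_labeling V E f" and ext: "p \<subseteq>\<^sub>m Some \<circ> f" by blast
  have fuv: "f u = 0" "f v = m" using ext u v by (force simp: map_le_def dom_def)+
  have V: "u \<in> V" "v \<in> V" using assms(2) u v by auto
  obtain t where t: "{u, t} \<in> E" "f t = m"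
    using graceful_zero_has_maximal_neighbour[OF f V(1) fuv(1) assms(1)] .
  then have "t = v" using graceful_labeling_inj[OF f] fuv V edge_in_verts by simp
  with t(1) assms(5) show False by simp
qed

text \<open>The largest label is forced onto \<open>z\<close>, which is not adjacent to the label \<open>1\<close> on \<open>q\<close>.\<close>

lemma doomed_if_one_open_neighbour:
  assumes m: "2 \<le> m" and dom: "dom p \<subseteq> V" and w: "p w = Some 0" and q: "p q = Some 1"
    and apart: "neighbours w \<inter> neighbours q = {}"
    and closed: "\<And>t. {w, t} \<in> E \<Longrightarrow> t \<noteq> z \<Longrightarrow> \<exists>b. p t = Some b \<and> b < m - 1"
  shows "doomed p"
  unfolding doomed_def
proof
  assume "\<exists>f. graceful_labeling V E f \<and> p \<subseteq>\<^sub>m Some \<circ> f"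
  then obtain f where f: "graceful_labeling V E f" and "p \<subseteq>\<^sub>m Some \<circ> f" by blast
  then have ext: "f v = a" if "p v = Some a" for v a using that by (force simp: map_le_def dom_def)
  have V: "w \<in> V" "q \<in> V" using dom w q by auto
  have open_nbr: "t = z" if "{w, t} \<in> E" "m - 1 \<le> f t" for t
    using closed[OF that(1)] that(2) ext by fastforce
  obtain t where t: "{w, t} \<in> E" "f t = m"
    using graceful_zero_has_maximal_neighbour[OF f V(1)] ext[OF w] m by auto
  then have "t = z" using open_nbr by simp
  obtain x y where xy: "{x, y} \<in> E" "f y = f x + (m - 1)"
    by (rule graceful_edge_label_attained[OF f, of "m - 1"]) (use m in auto)
  note xyV = edge_in_verts[OF xy(1)]
  have "f x = 0 \<or> f x = 1" using xy(2) graceful_labeling_le[OF f xyV(2)] m by linarith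
  then show False
  proof
    assume "f x = 0"
    then have "x = w" using graceful_labeling_inj[OF f] ext[OF w] xyV V by simp
    then have "y = z" using open_nbr xy by simp
    then show False using \<open>f x = 0\<close> \<open>t = z\<close> t(2) xy(2) m by simp
  next
    assume "f x = 1"
    then have "x = q" using graceful_labeling_inj[OF f] ext[OF q] xyV V by simp
    moreover have "f y = f t" using \<open>f x = 1\<close> xy(2) t(2) m by simp
    then have "y = t" using graceful_labeling_inj[OF f] xyV edge_in_verts(2)[OF t(1)] by simp
    ultimately show False using apart xy(1) t(1) by (auto simp: neighbours_def)
  qed
qed

end


subsection \<open>Bipartite graphs\<close>

locale bipartite_labeling_game = labeling_game V E
  for V :: "'v set" and E :: "'v set set" +
  fixes side :: "'v \<Rightarrow> bool"
  assumes bipartite: "{u, v} \<in> E \<Longrightarrow> side u \<noteq> side v"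
begin

lemma edge_labels_crossE:
  assumes "l \<in> edge_labels p"
  obtains s t b c where "{s, t} \<in> E" "side s = side w" "side t \<noteq> side w"
    "p s = Some b" "p t = Some c" "l = \<bar>int b - int c\<bar>"
proof -
  obtain s t b c where st: "{s, t} \<in> E" "p s = Some b" "p t = Some c" "l = \<bar>int b - int c\<bar>"
    using assms by (auto simp: edge_labels_def)
  show ?thesis
  proof (cases "side s = side w")
    case True
    then show ?thesis using that[of s t b c] st bipartite by blast
  next
    case False
    then have "side t = side w" using bipartite[OF st(1)] by simp
    moreover have "{t, s} \<in> E" "l = \<bar>int c - int b\<bar>"
      using st(1,4) by (simp_all add: insert_commute abs_minus_commute)
    ultimately show ?thesis using that[of t s c b] False st(2,3) by simp
  qed
qed

lemma disjoint_neighbours_if_opposite: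
  assumes "side u \<noteq> side v"
  shows "neighbours u \<inter> neighbours v = {}"
  using assms bipartite by (fastforce simp: neighbours_def)

lemma legalI_bipartite:
  assumes p: "partial_graceful p" and v: "v \<in> V" "p v = None" and a: "a \<le> m" "a \<notin> ran p"
    and new: "\<And>t b s s' c c'. {v, t} \<in> E \<Longrightarrow> p t = Some b \<Longrightarrow> {s, s'} \<in> E \<Longrightarrow>
      side s = side v \<Longrightarrow> side s' \<noteq> side v \<Longrightarrow> p s = Some c \<Longrightarrow> p s' = Some c' \<Longrightarrow>
      \<bar>int a - int b\<bar> \<noteq> \<bar>int c - int c'\<bar>"
    and distinct: "\<And>s t b c. {v, s} \<in> E \<Longrightarrow> {v, t} \<in> E \<Longrightarrow> p s = Some b \<Longrightarrow> p t = Some c \<Longrightarrow>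
      \<bar>int a - int b\<bar> = \<bar>int a - int c\<bar> \<Longrightarrow> s = t"
  shows "legal p v a"
proof (rule legalI[OF p v a])
  show "\<bar>int a - int b\<bar> \<notin> edge_labels p" if "{v, t} \<in> E" "p t = Some b" for t b
    using new[OF that] by (metis edge_labels_crossE)
qed (rule distinct)

text \<open>The new edge label \<open>m - x\<close> can only clash with the label \<open>x\<close> of the edge between \<open>w\<close> and
  \<open>y\<close>, and only for \<open>2 * x = m\<close>.\<close>

lemma legal_maximum_on_zero_side:
  assumes p: "partial_graceful p" "p w = Some 0" "m \<notin> ran p"
    and z: "z \<in> V" "p z = None" "side z = side w"
    and opp: "\<And>t b. p t = Some b \<Longrightarrow> side t \<noteq> side w \<Longrightarrow> t = y \<and> b = x"
    and x: "2 * x \<le> m" and half: "2 * x = m \<Longrightarrow> {w, y} \<in> E \<Longrightarrow> {z, y} \<notin> E"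
  shows "legal p z m"
proof -
  have nbr: "t = y" "b = x" if "{z, t} \<in> E" "p t = Some b" for t b
    using opp[OF that(2)] bipartite[OF that(1)] z(3) by auto
  show ?thesis
  proof (rule legalI_bipartite[OF p(1) z(1,2) le_refl p(3)])
    fix t b s s' c c'
    assume t: "{z, t} \<in> E" "p t = Some b"
      and s: "{s, s'} \<in> E" "side s' \<noteq> side z" "p s = Some c" "p s' = Some c'"
    have s': "s' = y" "c' = x" using opp[OF s(4)] s(2) z(3) by auto
    have "c < m"
      using partial_graceful_le[OF p(1) s(3)] p(3) s(3) by (auto simp: ran_def order_le_less)
    show "\<bar>int m - int b\<bar> \<noteq> \<bar>int c - int c'\<bar>"
    proof
      assume "\<bar>int m - int b\<bar> = \<bar>int c - int c'\<bar>"
      then have "c = 0" "2 * x = m" using \<open>c < m\<close> x nbr[OF t] s'(2) by linarith+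
      moreover from this have "s = w" using partial_graceful_inj[OF p(1)] p(2) s(3) by simp
      ultimately show False using half s(1) s'(1) t(1) nbr[OF t] by simp
    qed
  qed (use nbr in blast)
qed

lemma doomed_if_extreme_labels_on_same_side:
  assumes p: "partial_graceful p" and w: "p w = Some 0" and z: "p z = Some m" "z \<noteq> w"
    and side: "side z = side w"
  shows "doomed p"
proof (rule doomed_if_extreme_labels_apart[OF _ _ w z(1)])
  show "0 < m" using partial_graceful_inj[OF p, of z 0 w] w z by (cases m) auto
  show "{w, z} \<notin> E" using bipartite side by blast
qed (use p partial_graceful_dom in simp)

lemma bob_wins_if_legal_maximum_on_zero_side:
  assumes "legal p z m" "p w = Some 0" "side z = side w"
  shows "bob_wins Bob p"
proof (rule bob_wins_if_doomed_upd[OF assms(1)])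
  have "z \<noteq> w" using assms by (auto simp: legal_def)
  then show "doomed (p(z \<mapsto> m))"
    using assms by (intro doomed_if_extreme_labels_on_same_side[where w = w and z = z])
      (auto simp: legal_def)
qed

definition zero_star :: "('v \<rightharpoonup> nat) \<Rightarrow> 'v \<Rightarrow> bool" where
  "zero_star p w \<longleftrightarrow> p w = Some 0 \<and> (\<forall>t\<in>dom p - {w}. side t \<noteq> side w)"

lemma zero_starD:
  "zero_star p w \<Longrightarrow> p t = Some b \<Longrightarrow> side t = side w \<Longrightarrow> t = w \<and> b = 0"
  by (cases "t = w") (auto simp: zero_star_def)

lemma zero_star_upd:
  assumes "zero_star p w" "side v \<noteq> side w"
  shows "zero_star (p(v \<mapsto> a)) w"
proof -
  have "v \<noteq> w" using assms(2) by blast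
  moreover have "\<forall>t\<in>insert v (dom p) - {w}. side t \<noteq> side w"
    using assms unfolding zero_star_def by blast
  ultimately show ?thesis using assms(1) unfolding zero_star_def by simp
qed

lemma legal_on_zero_star:
  assumes p: "partial_graceful p" "zero_star p w"
    and u: "{w, u} \<in> E" "p u = None" and a: "a \<le> m" "a \<notin> ran p"
  shows "legal p u a"
proof -
  have nbr: "t = w" "b = 0" if "{u, t} \<in> E" "p t = Some b" for t b
    using zero_starD[OF p(2) that(2)] bipartite[OF that(1)] bipartite[OF u(1)] by blast+
  show ?thesis
  proof (rule legalI_bipartite[OF p(1) edge_in_verts(2)[OF u(1)] u(2) a])
    fix t b s s' c c'
    assume t: "{u, t} \<in> E" "p t = Some b"
      and s: "side s' \<noteq> side u" "p s = Some c" "p s' = Some c'"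
    have "c' = 0" using zero_starD[OF p(2) s(3)] s(1) bipartite[OF u(1)] by blast
    moreover have "c \<noteq> a" using a(2) s(2) by (auto simp: ran_def)
    ultimately show "\<bar>int a - int b\<bar> \<noteq> \<bar>int c - int c'\<bar>" using nbr[OF t] by simp
  qed (use nbr in blast)
qed

lemma bob_wins_if_zero_star_nearly_closed:
  assumes p: "partial_graceful p" "zero_star p w" and few: "card (dom p) + 1 < m"
    and u: "{w, u} \<in> E" "p u = None"
    and closed: "\<And>t. {w, t} \<in> E \<Longrightarrow> t \<noteq> u \<Longrightarrow> t \<noteq> z \<Longrightarrow> \<exists>b. p t = Some b \<and> b < m - 1"
  shows "bob_wins Bob p"
proof -
  have w: "p w = Some 0" using p(2) by (simp add: zero_star_def)
  have "finite (dom p)" using finite_subset[OF partial_graceful_dom[OF p(1)] finite_verts] .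
  then obtain l where l: "l \<notin> ran p" "l \<le> card (dom p)" and below: "\<And>k. k < l \<Longrightarrow> k \<in> ran p"
    by (rule least_unused_label) blast
  have legal: "legal p u l" using l few by (intro legal_on_zero_star[OF p u]) auto
  have "l \<noteq> 0" using l(1) w by (metis ranI)
  then have "1 \<in> ran (p(u \<mapsto> l))" using below[of 1] u(2) by (cases "l = 1") auto
  then obtain q where q: "(p(u \<mapsto> l)) q = Some 1" by (auto simp: ran_def simp del: fun_upd_apply)
  have "zero_star (p(u \<mapsto> l)) w" using bipartite[OF u(1)] p(2) by (intro zero_star_upd) auto
  then have "side q \<noteq> side w" using zero_starD q by fastforce
  have "doomed (p(u \<mapsto> l))"
  proof (rule doomed_if_one_open_neighbour[where w = w and q = q and z = z])
    show "(p(u \<mapsto> l)) q = Some 1" by (rule q)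
    show "2 \<le> m" using few w by (cases "dom p = {}") auto
    show "dom (p(u \<mapsto> l)) \<subseteq> V"
      using legal partial_graceful_dom by (simp add: legal_def del: dom_fun_upd)
    show "(p(u \<mapsto> l)) w = Some 0" using w u(2) by auto
    show "neighbours w \<inter> neighbours q = {}"
      using \<open>side q \<noteq> side w\<close> by (intro disjoint_neighbours_if_opposite) simp
    show "\<exists>b. (p(u \<mapsto> l)) t = Some b \<and> b < m - 1" if "{w, t} \<in> E" "t \<noteq> z" for t
      using closed[OF that(1) _ that(2)] l(2) few by (cases "t = u") auto
  qed
  with legal show ?thesis by (rule bob_wins_if_doomed_upd)
qed

lemma bob_wins_if_zero_star_extended:
  assumes p: "zero_star p w" "partial_graceful (p(y \<mapsto> x))"
    and y: "p y = None" "side y \<noteq> side w"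
    and small: "\<And>t b. {w, t} \<in> E \<Longrightarrow> p t = Some b \<Longrightarrow> b < m - 1"
    and few: "card (dom p) + 2 < m"
    and free: "neighbours w - dom p = {u\<^sub>1, u\<^sub>2}" "u\<^sub>1 \<noteq> u\<^sub>2"
  shows "bob_wins Bob (p(y \<mapsto> x))"
proof -
  obtain u z where uz: "{u, z} = {u\<^sub>1, u\<^sub>2}" "y \<noteq> u" using free(2) by (metis insert_commute)
  have free': "{w, t} \<in> E \<and> p t = None \<longleftrightarrow> t = u \<or> t = z" for t
    using free(1) unfolding uz(1)[symmetric] by (auto simp: neighbours_def set_eq_iff dom_def)
  show ?thesis
  proof (rule bob_wins_if_zero_star_nearly_closed[OF p(2), where w = w and u = u and z = z])
    show "zero_star (p(y \<mapsto> x)) w" using p(1) y(2) by (rule zero_star_upd)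
    have "dom p \<subseteq> V" using partial_graceful_dom[OF p(2)] by simp
    then have "finite (dom p)" using finite_verts by (rule finite_subset)
    then show "card (dom (p(y \<mapsto> x))) + 1 < m" using few y(1) by (simp add: domIff)
    show "\<exists>b. (p(y \<mapsto> x)) t = Some b \<and> b < m - 1" if t: "{w, t} \<in> E" "t \<noteq> u" "t \<noteq> z" for t
    proof -
      obtain b where "p t = Some b" using free'[of t] t by (cases "p t") auto
      then show ?thesis using small[OF t(1)] y(1) by auto
    qed
  qed (use free'[of u] uz(2) in auto)
qed

lemma bob_wins_after_zero:
  assumes p: "partial_graceful p" "zero_star p w"
    and small: "\<And>t b. {w, t} \<in> E \<Longrightarrow> p t = Some b \<Longrightarrow> b < m - 1"
    and few: "card (dom p) + 2 < m"
    and free: "neighbours w - dom p = {u\<^sub>1, u\<^sub>2}" "u\<^sub>1 \<noteq> u\<^sub>2"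
    and separable: "\<And>y x. legal p y x \<Longrightarrow> side y = side w \<Longrightarrow> x \<noteq> m \<Longrightarrow>
      \<exists>z. side z = side w \<and> legal (p(y \<mapsto> x)) z m"
  shows "bob_wins Alice p"
proof (rule bob_wins.alice_move)
  have "u\<^sub>1 \<in> neighbours w - dom p" using free(1) by simp
  then have "u\<^sub>1 \<in> V - dom p" using edge_in_verts(2)[of w u\<^sub>1] by (auto simp: neighbours_def)
  then show "dom p \<noteq> V" by blast
  fix y x assume legal: "legal p y x"
  then have p': "partial_graceful (p(y \<mapsto> x))" and y: "p y = None" by (simp_all add: legal_def)
  have w: "(p(y \<mapsto> x)) w = Some 0" using p(2) y by (auto simp: zero_star_def)
  consider "side y = side w" "x = m" | "side y = side w" "x \<noteq> m" | "side y \<noteq> side w" by blast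
  then show "bob_wins Bob (p(y \<mapsto> x))"
  proof cases
    case 1
    have "doomed (p(y \<mapsto> x))"
      by (rule doomed_if_extreme_labels_on_same_side[OF p' w, where z = y])
        (use 1 p(2) y in \<open>auto simp: zero_star_def\<close>)
    then show ?thesis by (rule bob_wins.doomed)
  next
    case 2
    then show ?thesis using separable[OF legal] bob_wins_if_legal_maximum_on_zero_side w by blast
  next
    case 3
    then show ?thesis using bob_wins_if_zero_star_extended p(2) p' y small few free by blast
  qed
qed

lemma bob_wins_by_opening_with_zero:
  assumes w: "w \<in> V" and nbrs: "neighbours w = {u\<^sub>1, u\<^sub>2}" "u\<^sub>1 \<noteq> u\<^sub>2" and m: "3 < m"
    and reserve: "\<And>y. \<exists>z\<in>V - {w, y}. side z = side w"
  shows "bob_wins Bob Map.empty"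
proof (rule bob_wins.bob_move)
  show legal: "legal Map.empty w 0" using w by (simp add: legal_empty)
  show "bob_wins Alice [w \<mapsto> 0]"
  proof (rule bob_wins_after_zero[where w = w])
    show "partial_graceful [w \<mapsto> 0]" using legal by (simp add: legal_def)
    show "zero_star [w \<mapsto> 0] w" by (simp add: zero_star_def)
    show "neighbours w - dom [w \<mapsto> 0] = {u\<^sub>1, u\<^sub>2}"
      using nbrs(1) no_loop by (force simp: neighbours_def)
    fix y x assume y: "legal [w \<mapsto> 0] y x" "side y = side w" "x \<noteq> m"
    obtain z where z: "z \<in> V" "z \<noteq> w" "z \<noteq> y" "side z = side w" using reserve by blast
    have "legal [w \<mapsto> 0, y \<mapsto> x] z m"
    proof (rule legal_if_no_labeled_neighbour)
      show "neighbours z \<inter> dom [w \<mapsto> 0, y \<mapsto> x] = {}"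
        using y(2) z(4) bipartite by (auto simp: neighbours_def split: if_splits)
    qed (use y z m in \<open>auto simp: legal_def split: if_splits\<close>)
    with z(4) show "\<exists>z. side z = side w \<and> legal [w \<mapsto> 0, y \<mapsto> x] z m" by blast
  qed (use nbrs(2) m in \<open>auto split: if_splits\<close>)
qed

lemma bob_wins_by_answering_with_zero:
  assumes y: "y \<in> V" "side y \<noteq> side w" and w: "w \<in> V" and x: "x \<noteq> 0" "2 * x \<le> m"
    and nbrs: "neighbours w - {y} = {u\<^sub>1, u\<^sub>2}" "u\<^sub>1 \<noteq> u\<^sub>2" and m: "4 < m"
    and reserve: "\<And>y'. \<exists>z\<in>V - {w, y'}. side z = side w \<and>
      (2 * x = m \<longrightarrow> {w, y} \<in> E \<longrightarrow> {z, y} \<notin> E)"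
  shows "bob_wins Bob [y \<mapsto> x]"
proof (rule bob_wins.bob_move)
  let ?p = "[y \<mapsto> x, w \<mapsto> 0]"
  have "y \<noteq> w" using y(2) by blast
  then show legal: "legal [y \<mapsto> x] w 0" using y w x by (intro legal_singleton) auto
  show "bob_wins Alice ?p"
  proof (rule bob_wins_after_zero[where w = w])
    show "partial_graceful ?p" using legal by (simp add: legal_def)
    show "zero_star ?p w" using y(2) by (auto simp: zero_star_def)
    show "neighbours w - dom ?p = {u\<^sub>1, u\<^sub>2}"
      using nbrs(1) no_loop by (force simp: neighbours_def)
    fix y' x' assume y': "legal ?p y' x'" "side y' = side w" "x' \<noteq> m"
    obtain z where z: "z \<in> V" "z \<noteq> w" "z \<noteq> y'" "side z = side w"
      "2 * x = m \<longrightarrow> {w, y} \<in> E \<longrightarrow> {z, y} \<notin> E" using reserve by blast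
    have "legal (?p(y' \<mapsto> x')) z m"
    proof (rule legal_maximum_on_zero_side[where w = w and y = y and x = x])
      show "t = y \<and> b = x" if "(?p(y' \<mapsto> x')) t = Some b" "side t \<noteq> side w" for t b
        using that y'(2) by (auto split: if_splits)
      show "m \<notin> ran (?p(y' \<mapsto> x'))" using y'(3) x m by (auto simp: ran_def split: if_splits)
    qed (use y y' z x in \<open>auto simp: legal_def split: if_splits\<close>)
    with z(4) show "\<exists>z. side z = side w \<and> legal (?p(y' \<mapsto> x')) z m" by blast
  qed (use nbrs(2) m x y \<open>y \<noteq> w\<close> in \<open>auto split: if_splits\<close>)
qed

lemma legal_one_next_to_zero:
  assumes p: "partial_graceful [y \<mapsto> x, w \<mapsto> 0, v \<mapsto> m]"
    and side: "side y = side w" "side v \<noteq> side w" and x: "2 < x" "2 * x \<le> m"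
    and u: "{w, u} \<in> E" "u \<noteq> v"
  shows "legal [y \<mapsto> x, w \<mapsto> 0, v \<mapsto> m] u 1"
proof (rule legalI_bipartite[OF p])
  let ?p = "[y \<mapsto> x, w \<mapsto> 0, v \<mapsto> m]"
  have side_u: "side u \<noteq> side w" using bipartite[OF u(1)] by simp
  have near: "t = w \<and> b = 0 \<or> t = y \<and> b = x" if "?p t = Some b" "side t \<noteq> side u" for t b
    using that side side_u by (auto split: if_splits)
  have far: "b = m" if "?p t = Some b" "side t = side u" for t b
    using that side side_u by (auto split: if_splits)
  show "u \<in> V" using edge_in_verts(2)[OF u(1)] .
  show "?p u = None" using side side_u u(2) by auto
  fix t b assume t: "{u, t} \<in> E" "?p t = Some b"
  show "\<bar>int 1 - int b\<bar> \<noteq> \<bar>int c - int c'\<bar>"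
    if "side s = side u" "side s' \<noteq> side u" "?p s = Some c" "?p s' = Some c'" for s s' c c'
    using near[OF t(2)] near[OF that(4,2)] far[OF that(3,1)] bipartite[OF t(1)] x by auto
  show "t = t'"
    if "{u, t'} \<in> E" "?p t' = Some b'" "\<bar>int 1 - int b\<bar> = \<bar>int 1 - int b'\<bar>" for t' b'
    using near[OF t(2)] near[OF that(2)] bipartite[OF t(1)] bipartite[OF that(1)] that(3) x by auto
qed (use x in \<open>auto simp: ran_def split: if_splits\<close>)

lemma bob_wins_if_maximum_next_to_zero:
  assumes p: "partial_graceful [y \<mapsto> x, w \<mapsto> 0, v \<mapsto> m]" and w: "v \<noteq> w"
    and y: "side y = side w" and x: "2 < x" "2 * x \<le> m"
    and nbrs: "neighbours w = {u, v}" "u \<noteq> v"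
  shows "bob_wins Bob [y \<mapsto> x, w \<mapsto> 0, v \<mapsto> m]"
proof -
  let ?p = "[y \<mapsto> x, w \<mapsto> 0, v \<mapsto> m]"
  have E: "{w, u} \<in> E" "{w, v} \<in> E" using nbrs(1) by (auto simp: neighbours_def)
  have side: "side u \<noteq> side w" "side v \<noteq> side w" using bipartite E by blast+
  have legal: "legal ?p u 1" using p y side(2) x E(1) nbrs(2) by (rule legal_one_next_to_zero)
  have "doomed (?p(u \<mapsto> 1))"
  proof (rule doomed_if_one_open_neighbour[where w = w and q = u and z = v])
    show "dom (?p(u \<mapsto> 1)) \<subseteq> V"
      using legal partial_graceful_dom by (simp add: legal_def del: dom_fun_upd)
    show "neighbours w \<inter> neighbours u = {}"
      using side(1) by (intro disjoint_neighbours_if_opposite) simp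
    show "\<exists>b. (?p(u \<mapsto> 1)) t = Some b \<and> b < m - 1" if "{w, t} \<in> E" "t \<noteq> v" for t
      using that nbrs(1) x by (auto simp: neighbours_def)
  qed (use x w side(1) in auto)
  with legal show ?thesis by (rule bob_wins_if_doomed_upd)
qed

lemma bob_wins_by_answering_with_zero_on_same_side:
  assumes V: "y \<in> V" "w \<in> V" "y \<noteq> w" and y: "side y = side w" and x: "2 < x" "2 * x \<le> m"
    and nbrs: "neighbours w = {u\<^sub>1, u\<^sub>2}" "u\<^sub>1 \<noteq> u\<^sub>2"
    and reserve: "\<And>v. \<exists>z\<in>V - {w, y, v}. side z = side w \<and> {z, v} \<notin> E"
  shows "bob_wins Bob [y \<mapsto> x]"
proof (rule bob_wins.bob_move)
  let ?p = "[y \<mapsto> x, w \<mapsto> 0]"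
  show "legal [y \<mapsto> x] w 0" using V x by (intro legal_singleton) auto
  show "bob_wins Alice ?p"
  proof (rule bob_wins.alice_move)
    show "dom ?p \<noteq> V" using reserve[of w] by auto
    fix v a assume legal: "legal ?p v a"
    then have v: "v \<noteq> y" "v \<noteq> w" and p: "partial_graceful (?p(v \<mapsto> a))"
      by (auto simp: legal_def split: if_splits)
    consider "a \<noteq> m" | "a = m" "{w, v} \<notin> E" | "a = m" "{w, v} \<in> E" by blast
    then show "bob_wins Bob (?p(v \<mapsto> a))"
    proof cases
      case 1
      obtain z where z: "z \<in> V" "z \<noteq> w" "z \<noteq> y" "z \<noteq> v" "side z = side w" "{z, v} \<notin> E"
        using reserve by blast
      have "legal (?p(v \<mapsto> a)) z m"
      proof (rule legal_if_no_labeled_neighbour[OF p])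
        show "neighbours z \<inter> dom (?p(v \<mapsto> a)) = {}"
          using z y bipartite by (auto simp: neighbours_def)
      qed (use 1 x z in \<open>auto simp: ran_def split: if_splits\<close>)
      then show ?thesis by (rule bob_wins_if_legal_maximum_on_zero_side[where w = w])
        (use z v in auto)
    next
      case 2
      show ?thesis
        by (rule bob_wins.doomed, rule doomed_if_extreme_labels_apart[where u = w and v = v])
          (use 2 x v p partial_graceful_dom in \<open>auto simp del: dom_fun_upd\<close>)
    next
      case 3
      then have "v = u\<^sub>1 \<or> v = u\<^sub>2" using nbrs(1) by (auto simp: neighbours_def)
      then obtain u where "neighbours w = {u, v}" "u \<noteq> v" using nbrs by (metis insert_commute)
      then show ?thesis
        using bob_wins_if_maximum_next_to_zero[of y x w v u] p v y x 3(1) by simp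
    qed
  qed
qed

end


subsection \<open>Gear graphs\<close>

primrec on_rim :: "gear_vertex \<Rightarrow> bool" where
  "on_rim Hub \<longleftrightarrow> False"
| "on_rim (Rim j) \<longleftrightarrow> True"
| "on_rim (Mid j) \<longleftrightarrow> False"

locale gear_game =
  fixes n :: nat
  assumes n_ge_3: "3 \<le> n"
begin

sublocale bipartite_labeling_game "gear_verts n" "gear_edges n" on_rim
  by unfold_locales (rule simple_graph_gear, auto simp: gear_edges_def doubleton_eq_iff)

definition cyclic_Suc :: "nat \<Rightarrow> nat" where
  "cyclic_Suc j = (if Suc j = n then 0 else Suc j)"

definition cyclic_pred :: "nat \<Rightarrow> nat" where
  "cyclic_pred j = (if j = 0 then n - 1 else j - 1)"

lemma cyclic_Suc_less: "j < n \<Longrightarrow> cyclic_Suc j < n"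
  by (auto simp: cyclic_Suc_def)

lemma cyclic_pred_less: "j < n \<Longrightarrow> cyclic_pred j < n"
  by (auto simp: cyclic_pred_def)

lemma cyclic_Suc_eq_iff: "j < n \<Longrightarrow> k < n \<Longrightarrow> k = cyclic_Suc j \<longleftrightarrow> j = cyclic_pred k"
  by (auto simp: cyclic_Suc_def cyclic_pred_def)

lemma cyclic_Suc_neq: "cyclic_Suc j \<noteq> j" "cyclic_Suc (cyclic_Suc j) \<noteq> j"
  using n_ge_3 by (auto simp: cyclic_Suc_def)

lemma cyclic_pred_neq: "cyclic_pred j \<noteq> j"
  using n_ge_3 by (auto simp: cyclic_pred_def)

lemma m_eq: "m = 3 * n"
  using n_ge_3 by (rule card_gear_edges)

lemma gear_verts_iff [simp]:
  "Hub \<in> gear_verts n" "Rim j \<in> gear_verts n \<longleftrightarrow> j < n" "Mid j \<in> gear_verts n \<longleftrightarrow> j < n"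
  by (auto simp: gear_verts_def)

lemma gear_edges_iff [simp]:
  "{Hub, v} \<in> gear_edges n \<longleftrightarrow> (\<exists>j<n. v = Rim j)"
  "{Mid j, v} \<in> gear_edges n \<longleftrightarrow> j < n \<and> v \<in> {Rim j, Rim (cyclic_Suc j)}"
  by (auto simp: gear_edges_def cyclic_Suc_def doubleton_eq_iff mod_Suc)

lemma Rim_edges_iff:
  assumes "k < n"
  shows "{Rim k, v} \<in> gear_edges n \<longleftrightarrow> v \<in> {Hub, Mid k, Mid (cyclic_pred k)}"
proof (cases v)
  case (Rim j)
  then show ?thesis using bipartite[of "Rim k" v] by auto
next
  case Hub
  then show ?thesis using assms by (auto simp: insert_commute[of "Rim k"])
next
  case (Mid j)
  then show ?thesis
    using assms cyclic_pred_less cyclic_Suc_eq_iff[of j k]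
    by (auto simp: insert_commute[of "Rim k"])
qed

lemma neighbours_Mid: "j < n \<Longrightarrow> neighbours (Mid j) = {Rim j, Rim (cyclic_Suc j)}"
  by (auto simp: neighbours_def)

lemma neighbours_Rim: "k < n \<Longrightarrow> neighbours (Rim k) = {Hub, Mid k, Mid (cyclic_pred k)}"
  by (auto simp: neighbours_def Rim_edges_iff)

lemma bob_wins_opening: "bob_wins Bob Map.empty"
proof (rule bob_wins_by_opening_with_zero[where w = "Mid 0"])
  show "neighbours (Mid 0) = {Rim 0, Rim (cyclic_Suc 0)}" using n_ge_3 by (simp add: neighbours_Mid)
  show "\<exists>z\<in>gear_verts n - {Mid 0, y}. on_rim z = on_rim (Mid 0)" for y
    using n_ge_3 by (intro bexI[of _ "if y = Hub then Mid 1 else Hub"]) auto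
qed (use n_ge_3 cyclic_Suc_neq[of 0] m_eq in auto)

lemma bob_wins_against_zero:
  assumes y: "y \<in> gear_verts n"
  shows "bob_wins Bob [y \<mapsto> 0]"
proof -
  obtain z where z: "z \<in> gear_verts n" "z \<noteq> y" "on_rim z = on_rim y"
  proof (cases y)
    case Hub
    then show ?thesis using that[of "Mid 0"] n_ge_3 by simp
  next
    case (Rim j)
    then show ?thesis using that[of "Rim (cyclic_Suc j)"] y cyclic_Suc_less cyclic_Suc_neq by simp
  next
    case (Mid j)
    then show ?thesis using that[of Hub] by simp
  qed
  have "legal [y \<mapsto> 0] z m" using y z n_ge_3 m_eq by (intro legal_singleton) auto
  then show ?thesis by (rule bob_wins_if_legal_maximum_on_zero_side[where w = y]) (use z in auto)
qed

lemma bob_wins_against_small_hub: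
  assumes x: "x \<noteq> 0" "2 * x < m"
  shows "bob_wins Bob [Hub \<mapsto> x]"
proof (rule bob_wins_by_answering_with_zero[where w = "Rim 0"])
  show "neighbours (Rim 0) - {Hub} = {Mid 0, Mid (cyclic_pred 0)}"
    using n_ge_3 by (auto simp: neighbours_Rim)
  show "\<exists>z\<in>gear_verts n - {Rim 0, y}. on_rim z = on_rim (Rim 0) \<and>
      (2 * x = m \<longrightarrow> {Rim 0, Hub} \<in> gear_edges n \<longrightarrow> {z, Hub} \<notin> gear_edges n)" for y
    using n_ge_3 x by (intro bexI[of _ "if y = Rim 1 then Rim 2 else Rim 1"]) auto
qed (use n_ge_3 x m_eq cyclic_pred_neq[of 0] in auto)

lemma bob_wins_against_middle_hub:
  assumes x: "2 * x = m"
  shows "bob_wins Bob [Hub \<mapsto> x]"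
proof (rule bob_wins_by_answering_with_zero_on_same_side[where w = "Mid 0"])
  show "neighbours (Mid 0) = {Rim 0, Rim (cyclic_Suc 0)}" using n_ge_3 by (simp add: neighbours_Mid)
  have "n \<noteq> 3" using x m_eq by presburger
  then have n4: "4 \<le> n" using n_ge_3 by simp
  show "\<exists>z\<in>gear_verts n - {Mid 0, Hub, v}.
      on_rim z = on_rim (Mid 0) \<and> {z, v} \<notin> gear_edges n" for v
  proof -
    define k where "k = (case v of Hub \<Rightarrow> 0 | Rim k \<Rightarrow> k | Mid k \<Rightarrow> k)"
    have "card {0, k, cyclic_pred k} < n" using n4 by (simp add: card_insert_if)
    then obtain i where "i < n" "i \<notin> {0, k, cyclic_pred k}"
      using ex_less_notin_if_card_less[of "{0, k, cyclic_pred k}" n] by blast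
    then show ?thesis
      using cyclic_Suc_eq_iff[of i k] cyclic_Suc_less[of i]
      by (intro bexI[of _ "Mid i"]) (auto simp: k_def split: gear_vertex.splits)
  qed
qed (use n_ge_3 x m_eq cyclic_Suc_neq[of 0] in auto)

lemma bob_wins_against_rim:
  assumes j: "j < n" and x: "x \<noteq> 0" "2 * x \<le> m"
  shows "bob_wins Bob [Rim j \<mapsto> x]"
proof (rule bob_wins_by_answering_with_zero[where w = "Mid (cyclic_Suc j)"])
  let ?i = "cyclic_Suc j"
  have i: "?i < n" "j \<notin> {?i, cyclic_Suc ?i}" using j cyclic_Suc_less cyclic_Suc_neq[of j] by auto
  then show "neighbours (Mid ?i) - {Rim j} = {Rim ?i, Rim (cyclic_Suc ?i)}"
    by (auto simp: neighbours_Mid)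
  show "\<exists>z\<in>gear_verts n - {Mid ?i, y}. on_rim z = on_rim (Mid ?i) \<and>
      (2 * x = m \<longrightarrow> {Mid ?i, Rim j} \<in> gear_edges n \<longrightarrow> {z, Rim j} \<notin> gear_edges n)"
    for y
    using i j cyclic_Suc_neq[of j] by (intro bexI[of _ "if y = Hub then Mid j else Hub"]) auto
qed (use n_ge_3 j x m_eq cyclic_Suc_less cyclic_Suc_neq[of "cyclic_Suc j"] in auto)

lemma bob_wins_against_mid:
  assumes j: "j < n" and x: "x \<noteq> 0" "2 * x \<le> m"
  shows "bob_wins Bob [Mid j \<mapsto> x]"
proof (rule bob_wins_by_answering_with_zero[where w = "Rim j"])
  show "neighbours (Rim j) - {Mid j} = {Hub, Mid (cyclic_pred j)}"
    using j cyclic_pred_neq[of j] by (auto simp: neighbours_Rim)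
  show "\<exists>z\<in>gear_verts n - {Rim j, y}. on_rim z = on_rim (Rim j) \<and>
      (2 * x = m \<longrightarrow> {Rim j, Mid j} \<in> gear_edges n \<longrightarrow> {z, Mid j} \<notin> gear_edges n)"
    for y
  proof -
    define k where "k = (case y of Hub \<Rightarrow> j | Rim k \<Rightarrow> k | Mid k \<Rightarrow> j)"
    define A where "A = (if 2 * x = m then {j, k, cyclic_Suc j} else {j, k})"
    have "n \<noteq> 3" if "2 * x = m" using that m_eq by presburger
    then have "card A < n" using n_ge_3 by (auto simp: A_def card_insert_if)
    then obtain i where i: "i < n" "i \<notin> A"
      using ex_less_notin_if_card_less[of A n] by (cases "2 * x = m") (auto simp: A_def)
    then have "2 * x = m \<Longrightarrow> {Rim i, Mid j} \<notin> gear_edges n"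
      by (auto simp: A_def insert_commute[of "Rim i"])
    with i show ?thesis
      by (intro bexI[of _ "Rim i"]) (auto simp: A_def k_def split: gear_vertex.splits if_splits)
  qed
qed (use n_ge_3 j x m_eq in auto)

lemma bob_wins_against_opening: "bob_wins Alice Map.empty"
proof (rule bob_wins_if_wins_against_small_openings)
  show "gear_verts n \<noteq> {}" using gear_verts_iff(1) by blast
  fix v a assume v: "v \<in> gear_verts n" and a: "2 * a \<le> m"
  show "bob_wins Bob [v \<mapsto> a]"
  proof (cases "a = 0")
    case True
    with v show ?thesis using bob_wins_against_zero by blast
  next
    case False
    with v a show ?thesis
      by (cases v; cases "2 * a = m")
        (auto intro: bob_wins_against_small_hub bob_wins_against_middle_hub
          bob_wins_against_rim bob_wins_against_mid)
  qed
qed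

end

theorem theorem8:
  fixes n :: nat and first :: player
  assumes "n \<ge> 3"
  shows "\<exists>\<sigma>. bob_winning_strategy (gear_verts n) (gear_edges n) first \<sigma>"
proof -
  interpret gear_game n using assms by unfold_locales
  show ?thesis
    using ex_bob_winning_strategy bob_wins_opening bob_wins_against_opening by (cases first) auto
qed

end
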